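(* Let $\mathcal{O}$ be an Okubo algebra with isotropic norm over an arbitrary field $\mathbb{F}$, and let $x\in Z(\mathcal{O})$ satisfy $n(x,x*x)\neq 0$. Then the subgraph of the orthogonality graph $\Gamma_O(\mathcal{O})$ on the vertex set $V_x=\{[x],[x*x]\}$ is a connected component of diameter $1$.
   Context: For a field $\mathbb{F}$ (arbitrary characteristic) and nonzero $\alpha,\beta\in\mathbb{F}$, let $\mathcal{O}_{\alpha,\beta}$ be the $8$-dimensional $\mathbb{F}$-algebra with basis $z_{1,0},z_{2,0},z_{0,1},z_{0,2},z_{1,1},z_{2,2},z_{1,2},z_{2,1}$ and (bilinear, non-associative) multiplication $*$ given by the table (the entry in row $a$, column $b$ is $a*b$): $$\begin{array}{c|cccccccc} * & z_{1,0} & z_{2,0} & z_{0,1} & z_{0,2} & z_{1,1} & z_{2,2} & z_{1,2} & z_{2,1}\\ \hline z_{1,0} & z_{2,0} & 0 & -z_{1,1} & 0 & -z_{2,1} & 0 & 0 & -\alpha z_{0,1}\\ z_{2,0} & 0 & \alpha z_{1,0} & 0 & -z_{2,2} & 0 & -\alpha z_{1,2} & -\alpha z_{0,2} & 0\\ z_{0,1} & 0 & -z_{2,1} & z_{0,2} & 0 & 0 & -\beta z_{2,0} & 0 & -z_{2,2}\\ z_{0,2} & -z_{1,2} & 0 & 0 & \beta z_{0,1} & -\beta z_{1,0} & 0 & -\beta z_{1,1} & 0\\ z_{1,1} & 0 & -\alpha z_{0,1} & -z_{1,2} & 0 & z_{2,2} & 0 & -\beta z_{2,0} & 0\\ z_{2,2}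 & -\alpha z_{0,2} & 0 & 0 & -\beta z_{2,1} & 0 & \alpha\beta z_{1,1} & 0 & -\alpha\beta z_{1,0}\\ z_{1,2} & -z_{2,2} & 0 & -\beta z_{1,0} & 0 & 0 & -\alpha\beta z_{0,1} & \beta z_{2,1} & 0\\ z_{2,1} & 0 & -\alpha z_{1,1} & 0 & -\beta z_{2,0} & -\alpha z_{0,2} & 0 & 0 & \alpha z_{1,2}\end{array}$$ Its norm is the quadratic form $n$ with $n(z_{i,j})=0$ for all basis elements and polar form $n(a,b)=n(a+b)-n(a)-n(b)$ given on the basis by $n(z_{1,0},z_{2,0})=\alpha$, $n(z_{0,1},z_{0,2})=\beta$, $n(z_{1,1},z_{2,2})=n(z_{1,2},z_{2,1})=\alpha\beta$, and $0$ on all other pairs of basis elements. By the known classification, the Okubo algebras with isotropic norm over $\mathbb{F}$ are exactly the $\mathbb{F}$-algebras isomorphic to $\mathcal{O}_{\alpha,\beta}$ for some nonzero $\alpha,\beta\in\mathbb{F}$; take this as the definition, with $n$ transported along the isomorphism (it does not depend on the isomorphism, since $(x*y)*x=x*(y*x)=n(x)y$). $Z(\mathcal{O})$ is the set of zero divisors, i.e. nonzero $a$ such that $a*b=0$ or $b*a=0$ for some nonzero $b$; in $\mathcal{O}$ every zero divisor is two-sided. For $x\neq0$ write $[x]=\mathbb{F}x$. The orthogonality graph $\Gamma_O(\mathcal{O})$ is the undirected graph whose vertices are the lines $[a]$ with $a$ a two-sided zero divisor, two distinct vertices $[a],[b]$ being adjacent if and only if $a*b=b*a=0$. *)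

theory Defs
  imports "HOL-Analysis.Analysis" "Graph_Theory.Graph_Theory"
begin

section \<open>The algebras \<open>\<O>\<^bsub>\<alpha>,\<beta>\<^esub>\<close>\<close>

datatype okubo_idx = Z10 | Z20 | Z01 | Z02 | Z11 | Z22 | Z12 | Z21

lemma UNIV_okubo_idx: "UNIV = {Z10, Z20, Z01, Z02, Z11, Z22, Z12, Z21}"
  by (auto intro: okubo_idx.exhaust)

instance okubo_idx :: finite
  by standard (simp add: UNIV_okubo_idx)

definition okubo_z :: "okubo_idx \<Rightarrow> 'f::field ^ okubo_idx" where
  "okubo_z i = axis i 1"

text \<open>\<open>okubo_table \<alpha> \<beta> a b\<close> is the entry in row \<open>a\<close> and column \<open>b\<close> of the multiplication table;
  the nonzero entries are listed row by row.\<close>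

fun okubo_table :: "'f::field \<Rightarrow> 'f \<Rightarrow> okubo_idx \<Rightarrow> okubo_idx \<Rightarrow> 'f ^ okubo_idx" where
  "okubo_table \<alpha> \<beta> Z10 Z10 = okubo_z Z20"
| "okubo_table \<alpha> \<beta> Z10 Z01 = - okubo_z Z11"
| "okubo_table \<alpha> \<beta> Z10 Z11 = - okubo_z Z21"
| "okubo_table \<alpha> \<beta> Z10 Z21 = - (\<alpha> *s okubo_z Z01)"

| "okubo_table \<alpha> \<beta> Z20 Z20 = \<alpha> *s okubo_z Z10"
| "okubo_table \<alpha> \<beta> Z20 Z02 = - okubo_z Z22"
| "okubo_table \<alpha> \<beta> Z20 Z22 = - (\<alpha> *s okubo_z Z12)"
| "okubo_table \<alpha> \<beta> Z20 Z12 = - (\<alpha> *s okubo_z Z02)"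

| "okubo_table \<alpha> \<beta> Z01 Z20 = - okubo_z Z21"
| "okubo_table \<alpha> \<beta> Z01 Z01 = okubo_z Z02"
| "okubo_table \<alpha> \<beta> Z01 Z22 = - (\<beta> *s okubo_z Z20)"
| "okubo_table \<alpha> \<beta> Z01 Z21 = - okubo_z Z22"

| "okubo_table \<alpha> \<beta> Z02 Z10 = - okubo_z Z12"
| "okubo_table \<alpha> \<beta> Z02 Z02 = \<beta> *s okubo_z Z01"
| "okubo_table \<alpha> \<beta> Z02 Z11 = - (\<beta> *s okubo_z Z10)"
| "okubo_table \<alpha> \<beta> Z02 Z12 = - (\<beta> *s okubo_z Z11)"

| "okubo_table \<alpha> \<beta> Z11 Z20 = - (\<alpha> *s okubo_z Z01)"
| "okubo_table \<alpha> \<beta> Z11 Z01 = - okubo_z Z12"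
| "okubo_table \<alpha> \<beta> Z11 Z11 = okubo_z Z22"
| "okubo_table \<alpha> \<beta> Z11 Z12 = - (\<beta> *s okubo_z Z20)"

| "okubo_table \<alpha> \<beta> Z22 Z10 = - (\<alpha> *s okubo_z Z02)"
| "okubo_table \<alpha> \<beta> Z22 Z02 = - (\<beta> *s okubo_z Z21)"
| "okubo_table \<alpha> \<beta> Z22 Z22 = (\<alpha> * \<beta>) *s okubo_z Z11"
| "okubo_table \<alpha> \<beta> Z22 Z21 = - ((\<alpha> * \<beta>) *s okubo_z Z10)"

| "okubo_table \<alpha> \<beta> Z12 Z10 = - okubo_z Z22"
| "okubo_table \<alpha> \<beta> Z12 Z01 = - (\<beta> *s okubo_z Z10)"
| "okubo_table \<alpha> \<beta> Z12 Z22 = - ((\<alpha> * \<beta>) *s okubo_z Z01)"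
| "okubo_table \<alpha> \<beta> Z12 Z12 = \<beta> *s okubo_z Z21"

| "okubo_table \<alpha> \<beta> Z21 Z20 = - (\<alpha> *s okubo_z Z11)"
| "okubo_table \<alpha> \<beta> Z21 Z02 = - (\<beta> *s okubo_z Z20)"
| "okubo_table \<alpha> \<beta> Z21 Z11 = - (\<alpha> *s okubo_z Z02)"
| "okubo_table \<alpha> \<beta> Z21 Z21 = \<alpha> *s okubo_z Z12"

| "okubo_table \<alpha> \<beta> _ _ = 0"

definition okubo_mult :: "'f::field \<Rightarrow> 'f \<Rightarrow> 'f ^ okubo_idx \<Rightarrow> 'f ^ okubo_idx \<Rightarrow> 'f ^ okubo_idx" where
  "okubo_mult \<alpha> \<beta> x y = (\<Sum>i\<in>UNIV. \<Sum>j\<in>UNIV. (x $ i * y $ j) *s okubo_table \<alpha> \<beta> i j)"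

text \<open>The quadratic form vanishing on the basis and with the prescribed polar form, written in
  coordinates; see \<open>okubo_norm_z\<close> and \<open>polar_okubo_norm_z\<close> below.\<close>

definition okubo_norm :: "'f::field \<Rightarrow> 'f \<Rightarrow> 'f ^ okubo_idx \<Rightarrow> 'f" where
  "okubo_norm \<alpha> \<beta> x = \<alpha> * (x $ Z10 * x $ Z20) + \<beta> * (x $ Z01 * x $ Z02)
     + \<alpha> * \<beta> * (x $ Z11 * x $ Z22) + \<alpha> * \<beta> * (x $ Z12 * x $ Z21)"

definition polar :: "('a::plus \<Rightarrow> 'f::minus) \<Rightarrow> 'a \<Rightarrow> 'a \<Rightarrow> 'f" where
  "polar n a b = n (a + b) - n a - n b"

lemma sum_okubo_idx:
  "(\<Sum>i\<in>UNIV. f i) = f Z10 + f Z20 + f Z01 + f Z02 + f Z11 + f Z22 + f Z12 + f Z21"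
  for f :: "okubo_idx \<Rightarrow> 'b::comm_monoid_add"
  by (simp add: UNIV_okubo_idx add.assoc)

lemma okubo_z_nth: "okubo_z i $ j = (if j = i then 1 else 0)"
  by (simp add: okubo_z_def axis_def)

lemma okubo_mult_z: "okubo_mult \<alpha> \<beta> (okubo_z i) (okubo_z j) = okubo_table \<alpha> \<beta> i j"
  unfolding okubo_mult_def sum_okubo_idx by (cases i; cases j; simp add: okubo_z_nth)

lemma okubo_norm_z: "okubo_norm \<alpha> \<beta> (okubo_z i) = 0"
  by (cases i) (simp_all add: okubo_norm_def okubo_z_nth)

lemma polar_okubo_norm_z:
  "polar (okubo_norm \<alpha> \<beta>) (okubo_z i) (okubo_z j) =
    (if {i, j} = {Z10, Z20} then \<alpha>
     else if {i, j} = {Z01, Z02} then \<beta>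
     else if {i, j} = {Z11, Z22} \<or> {i, j} = {Z12, Z21} then \<alpha> * \<beta>
     else 0)"
  by (cases i; cases j; simp add: polar_def okubo_norm_def okubo_z_nth doubleton_eq_iff)


section \<open>Okubo algebras with isotropic norm\<close>

definition okubo_iso ::
  "('f::field \<Rightarrow> 'a::ab_group_add \<Rightarrow> 'a) \<Rightarrow> ('a \<Rightarrow> 'a \<Rightarrow> 'a) \<Rightarrow> 'f \<Rightarrow> 'f \<Rightarrow> ('a \<Rightarrow> 'f ^ okubo_idx) \<Rightarrow> bool" where
  "okubo_iso scl mul \<alpha> \<beta> \<phi> \<longleftrightarrow>
     Vector_Spaces.linear scl (*s) \<phi> \<and> bij \<phi> \<and>
     (\<forall>x y. \<phi> (mul x y) = okubo_mult \<alpha> \<beta> (\<phi> x) (\<phi> y))"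

text \<open>The norm \<open>n\<close> is a parameter, but it is determined by the algebra; see
  \<open>isotropic_okubo_norm_unique\<close> below.\<close>

definition isotropic_okubo ::
  "('f::field \<Rightarrow> 'a::ab_group_add \<Rightarrow> 'a) \<Rightarrow> ('a \<Rightarrow> 'a \<Rightarrow> 'a) \<Rightarrow> ('a \<Rightarrow> 'f) \<Rightarrow> bool" where
  "isotropic_okubo scl mul n \<longleftrightarrow>
     (\<exists>\<alpha> \<beta> \<phi>. \<alpha> \<noteq> 0 \<and> \<beta> \<noteq> 0 \<and> okubo_iso scl mul \<alpha> \<beta> \<phi> \<and> n = okubo_norm \<alpha> \<beta> \<circ> \<phi>)"

lemma okubo_mult_nth:
  "okubo_mult \<alpha> \<beta> x y $ Z10 = \<alpha> * (x $ Z20 * y $ Z20) - \<beta> * (x $ Z02 * y $ Z11)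
     - \<alpha> * \<beta> * (x $ Z22 * y $ Z21) - \<beta> * (x $ Z12 * y $ Z01)"
  "okubo_mult \<alpha> \<beta> x y $ Z20 = x $ Z10 * y $ Z10 - \<beta> * (x $ Z01 * y $ Z22)
     - \<beta> * (x $ Z11 * y $ Z12) - \<beta> * (x $ Z21 * y $ Z02)"
  "okubo_mult \<alpha> \<beta> x y $ Z01 = - \<alpha> * (x $ Z10 * y $ Z21) + \<beta> * (x $ Z02 * y $ Z02)
     - \<alpha> * (x $ Z11 * y $ Z20) - \<alpha> * \<beta> * (x $ Z12 * y $ Z22)"
  "okubo_mult \<alpha> \<beta> x y $ Z02 = - \<alpha> * (x $ Z20 * y $ Z12) + x $ Z01 * y $ Z01
     - \<alpha> * (x $ Z22 * y $ Z10) - \<alpha> * (x $ Z21 * y $ Z11)"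
  "okubo_mult \<alpha> \<beta> x y $ Z11 = - (x $ Z10 * y $ Z01) - \<beta> * (x $ Z02 * y $ Z12)
     + \<alpha> * \<beta> * (x $ Z22 * y $ Z22) - \<alpha> * (x $ Z21 * y $ Z20)"
  "okubo_mult \<alpha> \<beta> x y $ Z22 = - (x $ Z20 * y $ Z02) - x $ Z01 * y $ Z21
     + x $ Z11 * y $ Z11 - x $ Z12 * y $ Z10"
  "okubo_mult \<alpha> \<beta> x y $ Z12 = - \<alpha> * (x $ Z20 * y $ Z22) - x $ Z02 * y $ Z10
     - x $ Z11 * y $ Z01 + \<alpha> * (x $ Z21 * y $ Z21)"
  "okubo_mult \<alpha> \<beta> x y $ Z21 = - (x $ Z10 * y $ Z11) - x $ Z01 * y $ Z20
     - \<beta> * (x $ Z22 * y $ Z02) + \<beta> * (x $ Z12 * y $ Z12)"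
  unfolding okubo_mult_def sum_okubo_idx
  by (simp_all add: okubo_z_nth algebra_simps)

lemma okubo_mult_flexible:
  "okubo_mult \<alpha> \<beta> (okubo_mult \<alpha> \<beta> x y) x = okubo_norm \<alpha> \<beta> x *s y"
  "okubo_mult \<alpha> \<beta> x (okubo_mult \<alpha> \<beta> y x) = okubo_norm \<alpha> \<beta> x *s y"
proof -
  have "okubo_mult \<alpha> \<beta> (okubo_mult \<alpha> \<beta> x y) x $ i = (okubo_norm \<alpha> \<beta> x *s y) $ i"
    "okubo_mult \<alpha> \<beta> x (okubo_mult \<alpha> \<beta> y x) $ i = (okubo_norm \<alpha> \<beta> x *s y) $ i" for i
    by (cases i; simp add: okubo_mult_nth okubo_norm_def algebra_simps)+
  then show "okubo_mult \<alpha> \<beta> (okubo_mult \<alpha> \<beta> x y) x = okubo_norm \<alpha> \<beta> x *s y"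
    "okubo_mult \<alpha> \<beta> x (okubo_mult \<alpha> \<beta> y x) = okubo_norm \<alpha> \<beta> x *s y"
    by (simp_all add: vec_eq_iff)
qed

lemma isotropic_okubo_flexible:
  assumes "isotropic_okubo scl mul n"
  shows "mul (mul x y) x = scl (n x) y" "mul x (mul y x) = scl (n x) y"
proof -
  obtain \<alpha> \<beta> \<phi> where iso: "okubo_iso scl mul \<alpha> \<beta> \<phi>" and n: "n = okubo_norm \<alpha> \<beta> \<circ> \<phi>"
    using assms by (auto simp: isotropic_okubo_def)
  interpret Vector_Spaces.linear scl "(*s)" \<phi>
    using iso by (simp add: okubo_iso_def)
  have mul: "\<phi> (mul x y) = okubo_mult \<alpha> \<beta> (\<phi> x) (\<phi> y)" for x y
    using iso by (simp add: okubo_iso_def)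
  have "inj \<phi>" using iso by (auto simp: okubo_iso_def bij_def)
  moreover have "\<phi> (mul (mul x y) x) = \<phi> (scl (n x) y)"
    "\<phi> (mul x (mul y x)) = \<phi> (scl (n x) y)"
    by (simp_all add: mul n okubo_mult_flexible scale)
  ultimately show "mul (mul x y) x = scl (n x) y" "mul x (mul y x) = scl (n x) y"
    by (auto dest: injD)
qed

lemma isotropic_okubo_norm_unique:
  assumes "isotropic_okubo scl mul n" "isotropic_okubo scl mul n'"
  shows "n = n'"
proof
  fix x
  obtain \<alpha> \<beta> \<phi> where iso: "okubo_iso scl mul \<alpha> \<beta> \<phi>"
    using assms(1) by (auto simp: isotropic_okubo_def)
  interpret Vector_Spaces.linear scl "(*s)" \<phi>
    using iso by (simp add: okubo_iso_def)
  obtain y where y: "\<phi> y = okubo_z Z10"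
    using iso by (metis okubo_iso_def bij_pointE)
  have "scl (n x) y = scl (n' x) y"
    using isotropic_okubo_flexible(1)[OF assms(1)] isotropic_okubo_flexible(1)[OF assms(2)] by metis
  then have "n x *s okubo_z Z10 = n' x *s okubo_z Z10"
    by (metis y scale)
  then have "(n x *s okubo_z Z10) $ Z10 = (n' x *s okubo_z Z10) $ Z10" by (rule arg_cong)
  then show "n x = n' x" by (simp add: okubo_z_nth)
qed


section \<open>Zero divisors and the orthogonality graph\<close>

definition zero_divisors :: "('a::zero \<Rightarrow> 'a \<Rightarrow> 'a) \<Rightarrow> 'a set" where
  "zero_divisors mul = {a. a \<noteq> 0 \<and> (\<exists>b. b \<noteq> 0 \<and> (mul a b = 0 \<or> mul b a = 0))}"

definition two_sided_zero_divisors :: "('a::zero \<Rightarrow> 'a \<Rightarrow> 'a) \<Rightarrow> 'a set" where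
  "two_sided_zero_divisors mul =
     {a. a \<noteq> 0 \<and> (\<exists>b. b \<noteq> 0 \<and> mul a b = 0) \<and> (\<exists>b. b \<noteq> 0 \<and> mul b a = 0)}"

definition line :: "('f \<Rightarrow> 'a \<Rightarrow> 'a) \<Rightarrow> 'a \<Rightarrow> 'a set" where
  "line scl x = range (\<lambda>c. scl c x)"

text \<open>Undirected graphs are represented as symmetric digraphs without parallel arcs.\<close>

definition orthogonality_graph ::
  "('f \<Rightarrow> 'a::zero \<Rightarrow> 'a) \<Rightarrow> ('a \<Rightarrow> 'a \<Rightarrow> 'a) \<Rightarrow> ('a set, 'a set \<times> 'a set) pre_digraph" where
  "orthogonality_graph scl mul = with_proj
     \<lparr> pverts = line scl ` two_sided_zero_divisors mul,
       parcs = {(line scl a, line scl b) | a b.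
         a \<in> two_sided_zero_divisors mul \<and> b \<in> two_sided_zero_divisors mul \<and>
         line scl a \<noteq> line scl b \<and> mul a b = 0 \<and> mul b a = 0} \<rparr>"

lemma sym_digraph_orthogonality_graph: "sym_digraph (orthogonality_graph scl mul)"
proof unfold_locales
  show "symmetric (orthogonality_graph scl mul)"
    unfolding symmetric_def orthogonality_graph_def with_proj_simps by (rule symI) auto
qed (auto simp: orthogonality_graph_def)

lemma loopfree_digraph_orthogonality_graph: "loopfree_digraph (orthogonality_graph scl mul)"
  by unfold_locales (auto simp: orthogonality_graph_def)

text \<open>A maximal connected subgraph; \<open>connected\<close> refers to the underlying undirected graph.\<close>

definition graph_component :: "('v, 'e) pre_digraph \<Rightarrow> ('v, 'e) pre_digraph \<Rightarrow> bool" where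
  "graph_component G H \<longleftrightarrow> pre_digraph.max_subgraph G Digraph_Component.connected H"

text \<open>With unit weights, \<open>\<mu>\<close> is the length of a shortest walk (\<open>\<infinity>\<close> if there is none).\<close>

definition graph_diameter :: "('v, 'e) pre_digraph \<Rightarrow> ereal" where
  "graph_diameter G = (SUP u\<in>verts G. SUP v\<in>verts G. wf_digraph.\<mu> G (\<lambda>_. 1) u v)"

end

theory Submission
  imports Defs
begin

text \<open>Linearizing \<open>(x * y) * x = n(x) y\<close> gives \<open>(x * y) * z + (z * y) * x = n(x, z) y\<close>.
  A zero divisor \<open>x\<close> has \<open>n(x) = 0\<close>, so \<open>y = x * x\<close> satisfies \<open>x * y = y * x = 0\<close>, and
  \<open>y * y = g x\<close> where \<open>g = n(x, y) \<noteq> 0\<close>. If \<open>x * a = a * x = 0\<close> then \<open>y * a = n(x, a) x\<close>, so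
  \<open>g a = (y * a) * x = n(x, a) y\<close>: the only neighbour of \<open>[x]\<close> is \<open>[y]\<close>. As \<open>y\<close> satisfies the
  same hypotheses, the only neighbour of \<open>[y]\<close> is \<open>[y * y] = [x]\<close>.\<close>

section \<open>Connected components from vertex sets that no arc leaves\<close>

lemma connected_induce_eq:
  assumes S: "S \<subseteq> verts H" "S \<noteq> {}" and conn: "Digraph_Component.connected H"
    and closed: "\<And>e. e \<in> arcs H \<Longrightarrow> tail H e \<in> S \<longleftrightarrow> head H e \<in> S"
  shows "verts H = S"
proof
  obtain u where u: "u \<in> S" using S by blast
  show "verts H \<subseteq> S"
  proof
    fix v assume "v \<in> verts H"
    then have "(u, v) \<in> rtrancl_on (verts H) ((arcs_ends H)\<^sup>s)"
      using conn u S by (auto simp: connected_conv)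
    then show "v \<in> S"
      \<comment> \<open>A step may traverse an arc in either direction; \<open>closed\<close> is an
        equivalence and so covers both.\<close>
      by (induction rule: rtrancl_on_induct) (use u closed in \<open>auto simp: symcl_def arcs_ends_conv\<close>)
  qed
qed (rule S)

text \<open>A connected subgraph containing \<open>G \<restriction> S\<close> cannot reach a vertex
  outside \<open>S\<close>, and the induced subgraph already has every arc of \<open>G\<close>
  inside \<open>S\<close>, so nothing can be added.\<close>

lemma (in wf_digraph) graph_component_induceI:
  assumes S: "S \<subseteq> verts G" and conn: "Digraph_Component.connected (G \<restriction> S)"
    and closed: "\<And>e. e \<in> arcs G \<Longrightarrow> tail G e \<in> S \<longleftrightarrow> head G e \<in> S"
  shows "graph_component G (G \<restriction> S)"
  unfolding graph_component_def
proof (rule max_subgraphI)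
  show "subgraph (G \<restriction> S) G" using S by (rule subgraph_induce_subgraphI)
next
  fix H assume ne: "G \<restriction> S \<noteq> H" and sub: "subgraph (G \<restriction> S) H" "subgraph H G"
  show "\<not> Digraph_Component.connected H"
  proof
    assume "Digraph_Component.connected H"
    moreover have "S \<noteq> {}" using conn by (auto simp: connected_conv)
    moreover have "tail H = tail G" "head H = head G" "arcs H \<subseteq> arcs G"
      using sub by (auto simp: subgraph_def compatible_def)
    ultimately have V: "verts H = S"
      using sub(1) closed by (intro connected_induce_eq) (auto simp: subgraph_def)
    interpret H: wf_digraph H using sub by (auto simp: subgraph_def)
    have "arcs H = arcs (G \<restriction> S)"
      using sub V H.wellformed by (auto simp: subgraph_def compatible_def)
    then have "G \<restriction> S = H"
      using V sub by (intro pre_digraph.equality) (auto simp: subgraph_def compatible_def)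
    with ne show False ..
  qed
qed (rule conn)

section \<open>Connectedness and diameter of complete graphs\<close>

lemma connected_if_complete:
  assumes "verts G \<noteq> {}"
    and "\<And>u v. u \<in> verts G \<Longrightarrow> v \<in> verts G \<Longrightarrow> u \<noteq> v \<Longrightarrow> (u, v) \<in> arcs_ends G"
  shows "Digraph_Component.connected G"
  unfolding connected_conv
proof (intro conjI ballI)
  fix u v assume uv: "u \<in> verts G" "v \<in> verts G"
  show "(u, v) \<in> rtrancl_on (verts G) ((arcs_ends G)\<^sup>s)"
  proof (cases "u = v")
    case False
    then have "(u, v) \<in> (arcs_ends G)\<^sup>s" using assms uv by (auto simp: symcl_def)
    then show ?thesis using uv by (meson rtrancl_on.simps)
  qed (use uv in auto)
qed (rule assms)

context wf_digraph
begin

text \<open>The empty walk costs 0. An upper bound suffices, since the diameter is a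
  supremum.\<close>

lemma dist_refl: "v \<in> verts G \<Longrightarrow> \<mu> (\<lambda>_. 1) v v \<le> 0"
  using min_cost_le_walk_cost[of v "[]" v "\<lambda>_. 1"] by (simp add: awalk_Nil_iff zero_ereal_def)

lemma dist_adjacent:
  assumes "(u, v) \<in> arcs_ends G" "u \<noteq> v"
  shows "\<mu> (\<lambda>_. 1) u v = 1"
proof (rule antisym)
  obtain e where "e \<in> arcs G" "tail G e = u" "head G e = v"
    using assms by (auto simp: arcs_ends_conv)
  then have "awalk u [e] v" by (auto simp: awalk_Cons_iff awalk_Nil_iff)
  from min_cost_le_walk_cost[OF this, of "\<lambda>_. 1"] show "\<mu> (\<lambda>_. 1) u v \<le> 1"
    by (simp add: one_ereal_def)
  show "1 \<le> \<mu> (\<lambda>_. 1) u v"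
    unfolding \<mu>_def
  proof (rule INF_greatest)
    fix p assume "p \<in> {p. awalk u p v}"
    \<comment> \<open>A walk between distinct vertices has an arc, and with unit weights its cost is
      its length.\<close>
    with \<open>u \<noteq> v\<close> have "p \<noteq> []" by (auto simp: awalk_Nil_iff)
    then have "1 \<le> real (length p)" by (cases p) auto
    then show "1 \<le> ereal (awalk_cost (\<lambda>_. 1) p)"
      by (simp add: awalk_cost_def sum_list_triv one_ereal_def)
  qed
qed

text \<open>The two distinct vertices make the supremum reach 1; pairs of equal vertices contribute
  at most 0.\<close>

lemma graph_diameter_complete:
  assumes "u \<in> verts G" "v \<in> verts G" "u \<noteq> v"
    and complete: "\<And>u v. u \<in> verts G \<Longrightarrow> v \<in> verts G \<Longrightarrow> u \<noteq> v \<Longrightarrow> (u, v) \<in> arcs_ends G"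
  shows "graph_diameter G = 1"
  unfolding graph_diameter_def
proof (rule antisym)
  have "\<mu> (\<lambda>_. 1) u v \<le> 1" if "u \<in> verts G" "v \<in> verts G" for u v
  proof (cases "u = v")
    case True
    have "\<mu> (\<lambda>_. 1) u v \<le> 0" using that True dist_refl by simp
    also have "\<dots> \<le> 1" by simp
    finally show ?thesis .
  next
    case False
    then show ?thesis using dist_adjacent complete that by simp
  qed
  then show "(SUP u\<in>verts G. SUP v\<in>verts G. \<mu> (\<lambda>_. 1) u v) \<le> 1"
    by (intro SUP_least)
  have "1 = \<mu> (\<lambda>_. 1) u v" using assms dist_adjacent by simp
  also have "\<dots> \<le> (SUP v\<in>verts G. \<mu> (\<lambda>_. 1) u v)" by (rule SUP_upper) fact
  also have "\<dots> \<le> (SUP u\<in>verts G. SUP v\<in>verts G. \<mu> (\<lambda>_. 1) u v)"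
    using \<open>u \<in> verts G\<close> by (rule SUP_upper)
  finally show "1 \<le> (SUP u\<in>verts G. SUP v\<in>verts G. \<mu> (\<lambda>_. 1) u v)" .
qed

end

section \<open>Lines, and algebras whose product is tied to a norm\<close>

lemma (in vector_space) line_eq_line_iff:
  assumes "b \<noteq> 0"
  shows "line scale a = line scale b \<longleftrightarrow> (\<exists>c. c \<noteq> 0 \<and> a = scale c b)"
proof
  assume eq: "line scale a = line scale b"
  have "a = scale 1 a" "b = scale 1 b" by simp_all
  then have "a \<in> line scale b" "b \<in> line scale a"
    using eq unfolding line_def by (metis rangeI)+
  then show "\<exists>c. c \<noteq> 0 \<and> a = scale c b" using assms by (auto simp: line_def)
next
  assume "\<exists>c. c \<noteq> 0 \<and> a = scale c b"
  then obtain c where c: "c \<noteq> 0" "a = scale c b" by blast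
  \<comment> \<open>\<open>d / c\<close> is the coefficient of \<open>scale d b\<close> with respect
    to \<open>a\<close>.\<close>
  have "scale d b \<in> line scale a" "scale d a \<in> line scale b" for d
    using c rangeI[of "\<lambda>d. scale d a" "d / c"] by (auto simp: line_def)
  then show "line scale a = line scale b" by (auto simp: line_def)
qed

text \<open>Isolates what the argument uses of an Okubo algebra: the multiplication table enters
  only through bilinearity and the two norm laws. The behaviour of \<open>polar n\<close> is derived
  from these.\<close>

locale flexible_norm_algebra = vector_space scl
  for scl :: "'f::field \<Rightarrow> 'a::ab_group_add \<Rightarrow> 'a" +
  fixes mul :: "'a \<Rightarrow> 'a \<Rightarrow> 'a" (infixl \<open>\<star>\<close> 70) and n :: "'a \<Rightarrow> 'f"
  assumes add_mul: "(x + y) \<star> z = x \<star> z + y \<star> z"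
    and mul_add: "x \<star> (y + z) = x \<star> y + x \<star> z"
    and scale_mul: "scl c x \<star> y = scl c (x \<star> y)"
    and mul_scale: "x \<star> scl c y = scl c (x \<star> y)"
    and mul_mul_left: "(x \<star> y) \<star> x = scl (n x) y"
    and mul_mul_right: "x \<star> (y \<star> x) = scl (n x) y"
begin

lemma zero_mul [simp]: "0 \<star> x = 0"
  using scale_mul[of 0 0 x] by simp

lemma mul_zero [simp]: "x \<star> 0 = 0"
  using mul_scale[of x 0 0] by simp

lemma linearized: "(x \<star> y) \<star> z + (z \<star> y) \<star> x = scl (polar n x z) y"
proof -
  \<comment> \<open>The norm law at \<open>x + z\<close>, minus the laws at \<open>x\<close> and
    \<open>z\<close>, leaves the cross terms.\<close>
  have "scl (polar n x z) y = ((x + z) \<star> y) \<star> (x + z) - (x \<star> y) \<star> x - (z \<star> y) \<star> z"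
    by (simp only: mul_mul_left polar_def scale_left_diff_distrib)
  then show ?thesis by (simp add: add_mul mul_add)
qed

lemma polar_commute: "polar n x y = polar n y x"
  by (simp add: polar_def add.commute)

text \<open>Homogeneity is read off from \<open>linearized\<close>, whose left side is linear in the
  third factor. The middle factor is free; choosing the nonzero \<open>z\<close> allows cancelling
  it.\<close>

lemma polar_scale_right:
  assumes "z \<noteq> 0"
  shows "polar n x (scl c z) = c * polar n x z"
proof -
  have "scl (polar n x (scl c z)) z = scl (c * polar n x z) z"
    using linearized[of x z "scl c z"] linearized[of x z z]
    by (simp add: scale_mul mul_scale flip: scale_right_distrib scale_scale)
  then show ?thesis using assms by simp
qed

text \<open>If \<open>x \<star> b = 0\<close> with \<open>b \<noteq> 0\<close>, then
  \<open>0 = (x \<star> b) \<star> x = scl (n x) b\<close>; if \<open>b \<star> x = 0\<close>, the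
  other law is used.\<close>

lemma norm_zero_divisor: "x \<in> zero_divisors mul \<Longrightarrow> n x = 0"
  by (auto simp: zero_divisors_def) (metis mul_mul_left mul_mul_right mul_zero zero_mul scale_eq_0_iff)+

end

section \<open>Elements \<open>x\<close> with \<open>n x = 0\<close> and
  \<open>polar n x (x \<star> x) \<noteq> 0\<close>\<close>

locale regular_isotropic = flexible_norm_algebra +
  fixes x
  assumes nonzero: "x \<noteq> 0" and norm: "n x = 0" and polar_sq: "polar n x (x \<star> x) \<noteq> 0"
begin

lemma sq_mul: "(x \<star> x) \<star> x = 0" and mul_sq: "x \<star> (x \<star> x) = 0"
  using mul_mul_left[of x x] mul_mul_right[of x x] norm by simp_all

lemma sq_mul_sq: "(x \<star> x) \<star> (x \<star> x) = scl (polar n x (x \<star> x)) x"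
  using linearized[of x x "x \<star> x"] by (simp add: sq_mul)

lemma sq_nonzero: "x \<star> x \<noteq> 0"
  using sq_mul_sq polar_sq nonzero by auto

text \<open>Lets every fact about \<open>x\<close> be reused for its square. The norm vanishes
  because \<open>((x \<star> x) \<star> x) \<star> (x \<star> x) = 0\<close>; the new polar value is
  the square of the old one.\<close>

lemma regular_isotropic_sq: "regular_isotropic scl mul n (x \<star> x)"
proof unfold_locales
  show "n (x \<star> x) = 0"
    using mul_mul_left[of "x \<star> x" x] nonzero by (simp add: sq_mul)
  show "polar n (x \<star> x) ((x \<star> x) \<star> (x \<star> x)) \<noteq> 0"
    using polar_sq nonzero
    by (simp add: sq_mul_sq polar_scale_right) (simp add: polar_commute)
qed (rule sq_nonzero)

lemma line_sq_neq: "line scl x \<noteq> line scl (x \<star> x)"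
proof
  assume "line scl x = line scl (x \<star> x)"
  then obtain c where c: "c \<noteq> 0" "x = scl c (x \<star> x)"
    using line_eq_line_iff sq_nonzero by metis
  \<comment> \<open>This is \<open>mul_sq\<close> with the first factor rewritten; by
    \<open>sq_mul_sq\<close> the right side is a nonzero multiple of \<open>x\<close>.\<close>
  have "0 = scl c (x \<star> x) \<star> (x \<star> x)" using c(2) mul_sq by metis
  then show False using c(1) sq_mul_sq polar_sq nonzero by (simp add: scale_mul)
qed

lemma line_eq_line_sq:
  assumes "a \<noteq> 0" "x \<star> a = 0" "a \<star> x = 0"
  shows "line scl a = line scl (x \<star> x)"
proof -
  let ?y = "x \<star> x" and ?g = "polar n x (x \<star> x)"
  \<comment> \<open>Each of the two linearizations loses one term: here through
    \<open>a \<star> x = 0\<close>, below through \<open>x \<star> a = 0\<close>.\<close>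
  have "?y \<star> a = scl (polar n x a) x"
    using linearized[of x x a] assms by simp
  moreover have "(?y \<star> a) \<star> x = scl ?g a"
    using linearized[of x a ?y] assms by simp
  ultimately have "scl ?g a = scl (polar n x a) ?y" by (simp add: scale_mul)
  then have "scl (inverse ?g) (scl ?g a) = scl (polar n x a / ?g) ?y"
    by (simp add: field_simps)
  then have "a = scl (polar n x a / ?g) ?y" using polar_sq by simp
  moreover from this have "polar n x a / ?g \<noteq> 0" using \<open>a \<noteq> 0\<close> by auto
  ultimately show ?thesis using line_eq_line_iff[OF sq_nonzero] by blast
qed

lemma two_sided: "x \<in> two_sided_zero_divisors mul"
  using nonzero sq_nonzero sq_mul mul_sq by (auto simp: two_sided_zero_divisors_def)

text \<open>Arcs of the graph come with arbitrary representatives of their lines, so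
  \<open>x\<close> is replaced by any \<open>a\<close> spanning the same line.\<close>

lemma orthogonal_line_eq_line_sq:
  assumes "line scl a = line scl x" "b \<noteq> 0" "a \<star> b = 0" "b \<star> a = 0"
  shows "line scl b = line scl (x \<star> x)"
proof -
  obtain c where "c \<noteq> 0" "a = scl c x" using assms line_eq_line_iff nonzero by metis
  then show ?thesis using assms by (intro line_eq_line_sq) (auto simp: scale_mul mul_scale)
qed

lemma orthogonality_graph_sq:
  defines "\<Gamma> \<equiv> orthogonality_graph scl mul" and "V \<equiv> {line scl x, line scl (x \<star> x)}"
  shows "V \<subseteq> verts \<Gamma>"
    and "u \<in> V \<Longrightarrow> v \<in> V \<Longrightarrow> u \<noteq> v \<Longrightarrow> (u, v) \<in> arcs_ends (\<Gamma> \<restriction> V)"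
    and "e \<in> arcs \<Gamma> \<Longrightarrow> tail \<Gamma> e \<in> V \<longleftrightarrow> head \<Gamma> e \<in> V"
proof -
  interpret y: regular_isotropic scl mul n "x \<star> x" by (rule regular_isotropic_sq)
  \<comment> \<open>\<open>x\<close> annihilates \<open>x \<star> x\<close> on both sides, so it
    spans the line of the square of \<open>x \<star> x\<close>: squaring swaps the two
    lines.\<close>
  have yy: "line scl ((x \<star> x) \<star> (x \<star> x)) = line scl x"
    using y.line_eq_line_sq[OF nonzero] sq_mul mul_sq by simp
  show "V \<subseteq> verts \<Gamma>"
    using two_sided y.two_sided by (auto simp: \<Gamma>_def V_def orthogonality_graph_def)
  have arcs: "(line scl x, line scl (x \<star> x)) \<in> arcs \<Gamma>" "(line scl (x \<star> x), line scl x) \<in> arcs \<Gamma>"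
    using two_sided y.two_sided line_sq_neq sq_mul mul_sq
    unfolding \<Gamma>_def orthogonality_graph_def by fastforce+
  show "(u, v) \<in> arcs_ends (\<Gamma> \<restriction> V)" if "u \<in> V" "v \<in> V" "u \<noteq> v"
  proof -
    have "(u, v) \<in> arcs \<Gamma>" using arcs that by (auto simp: V_def)
    moreover have "tail \<Gamma> = fst" "head \<Gamma> = snd" by (simp_all add: \<Gamma>_def orthogonality_graph_def)
    ultimately show ?thesis using that by (force simp: arcs_ends_conv)
  qed
  \<comment> \<open>A neighbour of either line is the line of its square, which by \<open>yy\<close>
    is the other one.\<close>
  have *: "line scl b \<in> V" if "line scl a \<in> V" "b \<noteq> 0" "a \<star> b = 0" "b \<star> a = 0" for a b
    using that orthogonal_line_eq_line_sq[of a b] y.orthogonal_line_eq_line_sq[of a b] yy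
    by (auto simp: V_def)
  show "tail \<Gamma> e \<in> V \<longleftrightarrow> head \<Gamma> e \<in> V" if e: "e \<in> arcs \<Gamma>"
  proof -
    obtain a b where "e = (line scl a, line scl b)" "a \<noteq> 0" "b \<noteq> 0" "a \<star> b = 0" "b \<star> a = 0"
      using e by (auto simp: \<Gamma>_def orthogonality_graph_def two_sided_zero_divisors_def)
    \<comment> \<open>Orthogonality is symmetric, so the closure fact applies from either end of the
      arc.\<close>
    then show ?thesis
      using *[of a b] *[of b a] by (auto simp: \<Gamma>_def orthogonality_graph_def)
  qed
qed

end

section \<open>Application to Okubo algebras\<close>

lemma isotropic_okubo_flexible_norm_algebra:
  assumes "isotropic_okubo scl mul n"
  shows "flexible_norm_algebra scl mul n"
proof -
  obtain \<alpha> \<beta> \<phi> where iso: "okubo_iso scl mul \<alpha> \<beta> \<phi>"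
    using assms by (auto simp: isotropic_okubo_def)
  interpret Vector_Spaces.linear scl "(*s)" \<phi>
    using iso by (simp add: okubo_iso_def)
  have mul: "\<phi> (mul x y) = okubo_mult \<alpha> \<beta> (\<phi> x) (\<phi> y)" for x y
    using iso by (simp add: okubo_iso_def)
  have inj: "a = b" if "\<phi> a = \<phi> b" for a b
    using iso that by (auto simp: okubo_iso_def bij_def dest: injD)
  show ?thesis
  proof unfold_locales
    fix c x y z
    \<comment> \<open>By injectivity of \<open>\<phi>\<close> each law may be checked on images,
      where it is bilinearity of \<open>okubo_mult\<close>.\<close>
    show "mul (x + y) z = mul x z + mul y z" "mul x (y + z) = mul x y + mul x z"
      "mul (scl c x) y = scl c (mul x y)" "mul x (scl c y) = scl c (mul x y)"
      by (rule inj, simp add: mul add scale okubo_mult_def algebra_simps sum.distrib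
        vec.scale_sum_right vec.scale_left_distrib)+
  qed (rule isotropic_okubo_flexible[OF assms])+
qed

theorem proposition3p1:
  fixes scl :: "'f::field \<Rightarrow> 'a::ab_group_add \<Rightarrow> 'a"
    and mul :: "'a \<Rightarrow> 'a \<Rightarrow> 'a"
    and n :: "'a \<Rightarrow> 'f"
    and x :: 'a
  assumes "isotropic_okubo scl mul n"
    and "x \<in> zero_divisors mul"
    and "polar n x (mul x x) \<noteq> 0"
  defines "\<Gamma> \<equiv> orthogonality_graph scl mul"
    and "V \<equiv> {line scl x, line scl (mul x x)}"
  shows "graph_component \<Gamma> (\<Gamma> \<restriction> V) \<and> graph_diameter (\<Gamma> \<restriction> V) = 1"
proof -
  interpret flexible_norm_algebra scl mul n
    using assms(1) by (rule isotropic_okubo_flexible_norm_algebra)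
  interpret regular_isotropic scl mul n x
    using assms(2,3) norm_zero_divisor by unfold_locales (auto simp: zero_divisors_def)
  interpret \<Gamma>: sym_digraph \<Gamma>
    unfolding \<Gamma>_def by (rule sym_digraph_orthogonality_graph)
  interpret V: wf_digraph "\<Gamma> \<restriction> V" ..
  note \<Gamma> = orthogonality_graph_sq[folded \<Gamma>_def V_def]
  have complete: "(u, v) \<in> arcs_ends (\<Gamma> \<restriction> V)"
    if "u \<in> verts (\<Gamma> \<restriction> V)" "v \<in> verts (\<Gamma> \<restriction> V)" "u \<noteq> v" for u v
    using that \<Gamma>(2) by simp
  have "Digraph_Component.connected (\<Gamma> \<restriction> V)"
    using complete by (intro connected_if_complete) (auto simp: V_def)
  then have "graph_component \<Gamma> (\<Gamma> \<restriction> V)"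
    using \<Gamma>(1,3) by (intro \<Gamma>.graph_component_induceI)
  moreover have "graph_diameter (\<Gamma> \<restriction> V) = 1"
    by (rule V.graph_diameter_complete[OF _ _ line_sq_neq complete]) (simp_all add: V_def)
  ultimately show ?thesis ..
qed

end
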